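(* Let $n$ be a positive integer and $A=\{(i,j)\in\mathbb{Z}^2:0\le i,j<n\}$ identified with $(\mathbb{Z}/n\mathbb{Z})^2$. Let $S=\{(a_1,b_1),\dots,(a_k,b_k)\}$ be a set of pairwise independent admissible directions for $A$ and let $g:A\to\mathbb{R}$. Let $H_g$ be the set of functions $f:A\to\mathbb{R}$ with $L_f((a,b),t)=L_g((a,b),t)$ for all $(a,b)\in S$ and $t=1,\dots,n$, and let $D_g=\sum_{(i,j)\in A}g(i,j)$. Then the element of $H_g$ of smallest Euclidean norm is $f_0$ given by $$f_0(i,j)=\sum_{(a,b)\in S}\frac{L_g((a,b),t_{(a,b)}(i,j))}{n}-\frac{(k-1)D_g}{n^2}\qquad((i,j)\in A),$$ where $t_{(a,b)}(i,j)\in\{1,\dots,n\}$ is the index such that $(i,j)$ lies on the torus line $l_{(a,b),P_{t_{(a,b)}(i,j)}(a,b)}$.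
   Context: A direction $(a,b)\in\mathbb{Z}^2$ is admissible for $A$ if $0\le a<n$, $0\le b<n$ and $\gcd(a,b)=1$; two admissible directions $(a,b),(c,d)$ are independent if $\gcd(ad-bc,n)=1$. The torus line with direction $(a,b)$ through $(i,j)\in A$ is $l_{(a,b),(i,j)}=\{(x,y)\in A: bx-ay\equiv bi-aj\pmod n\}$. For each admissible $(a,b)$, the $n$ distinct torus lines with direction $(a,b)$ partition $A$; fix points $P_1(a,b),\dots,P_n(a,b)\in A$, one on each of them. For $f:A\to\mathbb{R}$ the torus line sums are $L_f((a,b),t)=\sum_{(i,j)\in l_{(a,b),P_t(a,b)}}f(i,j)$, $t=1,\dots,n$. Functions $A\to\mathbb{R}$ are identified with vectors in $\mathbb{R}^{n^2}$ with Euclidean norm. *)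

theory Defs
  imports "HOL-Analysis.L2_Norm" "HOL-Library.FuncSet" "HOL-Number_Theory.Cong"
begin

definition grid :: "nat \<Rightarrow> (int \<times> int) set" where
  "grid n = {0..<int n} \<times> {0..<int n}"

fun admissible_dir :: "nat \<Rightarrow> int \<times> int \<Rightarrow> bool" where
  "admissible_dir n (a, b) \<longleftrightarrow> 0 \<le> a \<and> a < int n \<and> 0 \<le> b \<and> b < int n \<and> gcd a b = 1"

fun independent_dirs :: "nat \<Rightarrow> int \<times> int \<Rightarrow> int \<times> int \<Rightarrow> bool" where
  "independent_dirs n (a, b) (c, d) \<longleftrightarrow> gcd (a * d - b * c) (int n) = 1"

fun torus_line :: "nat \<Rightarrow> int \<times> int \<Rightarrow> int \<times> int \<Rightarrow> (int \<times> int) set" where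
  "torus_line n (a, b) (i, j) =
     {(x, y). (x, y) \<in> grid n \<and> [b * x - a * y = b * i - a * j] (mod (int n))}"

text \<open>A choice of points \<open>P d 1, \<dots>, P d n\<close> in the grid, exactly one on each of the torus lines
  with direction \<open>d\<close>, for every admissible direction \<open>d\<close>.\<close>

definition line_points :: "nat \<Rightarrow> (int \<times> int \<Rightarrow> nat \<Rightarrow> int \<times> int) \<Rightarrow> bool" where
  "line_points n P \<longleftrightarrow>
     (\<forall>d. admissible_dir n d \<longrightarrow>
        (\<forall>t\<in>{1..n}. P d t \<in> grid n) \<and>
        bij_betw (\<lambda>t. torus_line n d (P d t)) {1..n} (torus_line n d ` grid n))"

definition line_sum ::
  "nat \<Rightarrow> (int \<times> int \<Rightarrow> nat \<Rightarrow> int \<times> int) \<Rightarrow> (int \<times> int \<Rightarrow> real) \<Rightarrow> int \<times> int \<Rightarrow> nat \<Rightarrow> real" where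
  "line_sum n P f d t = (\<Sum>p\<in>torus_line n d (P d t). f p)"

definition line_index ::
  "nat \<Rightarrow> (int \<times> int \<Rightarrow> nat \<Rightarrow> int \<times> int) \<Rightarrow> int \<times> int \<Rightarrow> int \<times> int \<Rightarrow> nat" where
  "line_index n P d p = (THE t. t \<in> {1..n} \<and> p \<in> torus_line n d (P d t))"

text \<open>Real functions on the grid are represented as extensional functions, so that equality of
  two such functions is equality on the grid.\<close>

definition same_line_sums ::
  "nat \<Rightarrow> (int \<times> int \<Rightarrow> nat \<Rightarrow> int \<times> int) \<Rightarrow> (int \<times> int) set \<Rightarrow> (int \<times> int \<Rightarrow> real)
     \<Rightarrow> (int \<times> int \<Rightarrow> real) set" where
  "same_line_sums n P S g =
     {f \<in> grid n \<rightarrow>\<^sub>E UNIV. \<forall>d\<in>S. \<forall>t\<in>{1..n}. line_sum n P f d t = line_sum n P g d t}"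

end

theory Submission
  imports Defs
begin

text \<open>Each summand of \<open>f\<^sub>0\<close> is constant on the lines of one direction of \<open>S\<close>, so \<open>f\<^sub>0\<close> is
  orthogonal to every function whose line sums in the directions of \<open>S\<close> vanish, in particular to
  \<open>f - f\<^sub>0\<close> for every competitor \<open>f\<close>; Pythagoras then gives minimality. That \<open>f\<^sub>0\<close> has the right line
  sums holds because lines in independent directions meet in exactly one point, so that summing
  the \<open>e\<close>-line sums of \<open>g\<close> along a \<open>d\<close>-line yields \<open>D\<^sub>g\<close> for \<open>e \<noteq> d\<close>.\<close>

section \<open>Torus lines as level sets of a linear form\<close>

text \<open>Up to sign the determinant of \<open>d\<close> and \<open>p\<close>. Its level sets
  modulo \<open>n\<close> are the torus lines of direction \<open>d\<close>, so membership becomes a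
  single congruence.\<close>

definition dir_form :: "int \<times> int \<Rightarrow> int \<times> int \<Rightarrow> int" where
  "dir_form d p = snd d * fst p - fst d * snd p"

lemma finite_grid [simp]: "finite (grid n)"
  by (simp add: grid_def)

lemma mem_torus_line:
  "q \<in> torus_line n d p \<longleftrightarrow> q \<in> grid n \<and> [dir_form d q = dir_form d p] (mod (int n))"
  by (cases d; cases p; cases q) (simp add: dir_form_def)

lemma torus_line_subset: "torus_line n d p \<subseteq> grid n"
  by (auto simp: mem_torus_line)

lemma finite_torus_line [simp]: "finite (torus_line n d p)"
  using finite_subset[OF torus_line_subset finite_grid] .

lemma torus_line_sym:
  assumes "p \<in> grid n" "q \<in> torus_line n d p"
  shows "p \<in> torus_line n d q"
  using assms by (auto simp: mem_torus_line cong_sym)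

lemma torus_line_eq:
  assumes "q \<in> torus_line n d p"
  shows "torus_line n d q = torus_line n d p"
  using assms unfolding set_eq_iff mem_torus_line by (meson cong_sym cong_trans)

lemma self_mem_torus_line: "p \<in> grid n \<Longrightarrow> p \<in> torus_line n d p"
  by (simp add: mem_torus_line)

section \<open>Intersections and sizes of torus lines\<close>

text \<open>Cramer's rule modulo \<open>n\<close>.\<close>

lemma ex1_grid_dir_form:
  assumes "n > 0" and "independent_dirs n d e"
  shows "\<exists>!q. q \<in> grid n \<and> [dir_form d q = s] (mod (int n)) \<and> [dir_form e q = r] (mod (int n))"
proof -
  obtain a b c c' where de: "d = (a, b)" "e = (c, c')"
    by (metis surj_pair)
  let ?D = "a * c' - b * c"
  have cop: "coprime ?D (int n)"
    using assms(2) by (simp add: de coprime_iff_gcd_eq_1)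
  obtain w where w: "[?D * w = 1] (mod (int n))"
    using cong_solve_coprime_int[OF cop] by blast
  \<comment> \<open>Cramer's solution of \<open>b * x - a * y = s\<close>,
    \<open>c' * x - c * y = r\<close>: the system has determinant \<open>?D\<close>, and
    \<open>w\<close> is its inverse modulo \<open>n\<close>. Reducing both coordinates puts the
    point in the grid.\<close>
  define q where "q = ((w * (a * r - c * s)) mod int n, (w * (b * r - c' * s)) mod int n)"
  have qg: "q \<in> grid n"
    using assms(1) by (simp add: q_def grid_def)
  have form_mod: "[u * (x mod int n) - v * (y mod int n) = u * x - v * y] (mod (int n))" for u v x y
    by (intro cong_diff cong_mult) (simp_all add: cong_def)
  have scale: "[?D * w * z = z] (mod (int n))" for z
    using cong_scalar_right[OF w, of z] by simp
  have "[dir_form d q = ?D * w * s] (mod (int n))"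
    using form_mod[of b "w * (a * r - c * s)" a "w * (b * r - c' * s)"]
    by (simp add: dir_form_def de q_def algebra_simps)
  hence 1: "[dir_form d q = s] (mod (int n))"
    using scale cong_trans by blast
  have "[dir_form e q = ?D * w * r] (mod (int n))"
    using form_mod[of c' "w * (a * r - c * s)" c "w * (b * r - c' * s)"]
    by (simp add: dir_form_def de q_def algebra_simps)
  hence 2: "[dir_form e q = r] (mod (int n))"
    using scale cong_trans by blast
  show ?thesis
  proof (rule ex1I[of _ q])
    fix q' assume q': "q' \<in> grid n \<and> [dir_form d q' = s] (mod (int n)) \<and> [dir_form e q' = r] (mod (int n))"
    obtain x y x' y' where xy: "q = (x, y)" "q' = (x', y')"
      by (metis surj_pair)
    have "[dir_form d q' = dir_form d q] (mod (int n))" "[dir_form e q' = dir_form e q] (mod (int n))"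
      using q' 1 2 by (meson cong_sym cong_trans)+
    hence D1: "int n dvd b * (x' - x) - a * (y' - y)" and D2: "int n dvd c' * (x' - x) - c * (y' - y)"
      by (simp_all add: cong_iff_dvd_diff xy de dir_form_def algebra_simps)
    \<comment> \<open>This combination eliminates \<open>y' - y\<close>, the later one
      \<open>x' - x\<close>; coprimality then cancels the remaining factor
      \<open>?D\<close>.\<close>
    have "int n dvd a * (c' * (x' - x) - c * (y' - y)) - c * (b * (x' - x) - a * (y' - y))"
      by (rule dvd_diff[OF dvd_mult[OF D2] dvd_mult[OF D1]])
    hence "int n dvd ?D * (x' - x)"
      by (simp add: algebra_simps)
    hence "int n dvd x' - x"
      using cop by (simp add: coprime_commute coprime_dvd_mult_right_iff)
    moreover have "int n dvd b * (c' * (x' - x) - c * (y' - y)) - c' * (b * (x' - x) - a * (y' - y))"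
      by (rule dvd_diff[OF dvd_mult[OF D2] dvd_mult[OF D1]])
    hence "int n dvd ?D * (y' - y)"
      by (simp add: algebra_simps)
    hence "int n dvd y' - y"
      using cop by (simp add: coprime_commute coprime_dvd_mult_right_iff)
    moreover have "x \<in> {0..<int n}" "y \<in> {0..<int n}" "x' \<in> {0..<int n}" "y' \<in> {0..<int n}"
      using q' qg by (auto simp: xy grid_def)
    ultimately show "q' = q"
      unfolding xy by (metis atLeastLessThan_iff cong_iff_dvd_diff cong_less_imp_eq_int)
  qed (use qg 1 2 in blast)
qed

text \<open>With \<open>a u + b v = 1\<close>, the form of the direction \<open>(-v, u)\<close> is a coordinate along the lines of
  direction \<open>(a, b)\<close>.\<close>

lemma card_torus_line:
  assumes "n > 0" and "admissible_dir n d"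
  shows "card (torus_line n d p) = n"
proof -
  obtain a b where d: "d = (a, b)"
    by (metis surj_pair)
  obtain u v where uv: "u * a + v * b = 1"
    using assms(2) bezout_int[of a b] by (auto simp: d)
  \<comment> \<open>The determinant of \<open>d\<close> and \<open>e\<close> is exactly 1, whatever
    \<open>n\<close> is.\<close>
  define e where "e = (- v, u)"
  have ind: "independent_dirs n d e"
    using uv by (simp add: d e_def algebra_simps)
  have "bij_betw (\<lambda>q. dir_form e q mod int n) (torus_line n d p) {0..<int n}"
    unfolding bij_betw_def
  proof (intro conjI inj_onI subset_antisym subsetI)
    fix q q' assume "q \<in> torus_line n d p" "q' \<in> torus_line n d p"
      and "dir_form e q mod int n = dir_form e q' mod int n"
    thus "q = q'"
      using ex1_grid_dir_form[OF assms(1) ind, of "dir_form d p" "dir_form e q'"]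
      by (auto simp: mem_torus_line cong_def)
  next
    fix r assume r: "r \<in> {0..<int n}"
    obtain q where "q \<in> torus_line n d p" "[dir_form e q = r] (mod (int n))"
      using ex1_grid_dir_form[OF assms(1) ind, of "dir_form d p" r] by (auto simp: mem_torus_line)
    thus "r \<in> (\<lambda>q. dir_form e q mod int n) ` torus_line n d p"
      using r by (auto simp: cong_def image_iff intro!: bexI[of _ q])
  qed (use assms(1) in auto)
  thus ?thesis
    by (simp add: bij_betw_same_card)
qed

section \<open>Double sums over torus lines\<close>

text \<open>Lying on a common line of direction \<open>d\<close> is a symmetric relation on the
  grid, so the order of summation can be exchanged.\<close>

lemma sum_torus_line_swap:
  "(\<Sum>q\<in>grid n. (\<Sum>r\<in>torus_line n d q. F q r)) = (\<Sum>r\<in>grid n. (\<Sum>q\<in>torus_line n d r. F q r))"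
proof -
  have "{r \<in> grid n. r \<in> torus_line n d q} = torus_line n d q" for q
    using torus_line_subset by blast
  moreover have "{q \<in> grid n. r \<in> torus_line n d q} = torus_line n d r" if "r \<in> grid n" for r
    using that torus_line_sym torus_line_subset by blast
  ultimately show ?thesis
    using sum.swap_restrict[of "grid n" "grid n" F "\<lambda>q r. r \<in> torus_line n d q"] by simp
qed

text \<open>Every grid point lies on the \<open>e\<close>-line of exactly one point of the given
  \<open>d\<close>-line, so these \<open>e\<close>-lines partition the grid.\<close>

lemma sum_torus_line_independent:
  assumes "n > 0" and "independent_dirs n d e"
  shows "(\<Sum>q\<in>torus_line n d p. \<Sum>r\<in>torus_line n e q. g r) = (\<Sum>r\<in>grid n. g r)"
proof -
  have "(\<Union>q\<in>torus_line n d p. torus_line n e q) = grid n"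
  proof (intro subset_antisym subsetI)
    fix r assume r: "r \<in> grid n"
    obtain q where "q \<in> torus_line n d p" "[dir_form e q = dir_form e r] (mod (int n))"
      using ex1_grid_dir_form[OF assms, of "dir_form d p" "dir_form e r"]
      by (auto simp: mem_torus_line)
    thus "r \<in> (\<Union>q\<in>torus_line n d p. torus_line n e q)"
      using r by (intro UN_I[of q]) (auto simp: mem_torus_line cong_sym)
  qed (use torus_line_subset in blast)
  moreover have "torus_line n e q \<inter> torus_line n e q' = {}"
    if "q \<in> torus_line n d p" "q' \<in> torus_line n d p" "q \<noteq> q'" for q q'
  proof (rule ccontr)
    assume "torus_line n e q \<inter> torus_line n e q' \<noteq> {}"
    then obtain r where "r \<in> torus_line n e q" "r \<in> torus_line n e q'"
      by blast
    hence "[dir_form e q = dir_form e r] (mod (int n))" "[dir_form e q' = dir_form e r] (mod (int n))"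
      by (auto simp: mem_torus_line cong_sym)
    thus False
      using that ex1_grid_dir_form[OF assms, of "dir_form d p" "dir_form e r"]
      by (auto simp: mem_torus_line)
  qed
  ultimately show ?thesis
    using sum.UNION_disjoint[of "torus_line n d p" "torus_line n e" g] by simp
qed

section \<open>Eliminating the representatives \<open>P\<close>\<close>

text \<open>Justifies the \<open>THE\<close> in \<open>line_index\<close>: a line containing
  \<open>p\<close> is the line through \<open>p\<close>, and \<open>line_points\<close> gives each
  line one index.\<close>

lemma line_index_torus_line:
  assumes "line_points n P" and "admissible_dir n d" and "p \<in> grid n"
  shows "line_index n P d p \<in> {1..n}"
    and "torus_line n d (P d (line_index n P d p)) = torus_line n d p"
proof -
  have bij: "bij_betw (\<lambda>t. torus_line n d (P d t)) {1..n} (torus_line n d ` grid n)"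
    using assms unfolding line_points_def by blast
  have iff: "p \<in> torus_line n d (P d t) \<longleftrightarrow> torus_line n d (P d t) = torus_line n d p" for t
    using torus_line_eq self_mem_torus_line[OF assms(3)] by metis
  have "\<exists>!t. t \<in> {1..n} \<and> p \<in> torus_line n d (P d t)"
    using bij_betw_imp_inj_on[OF bij] bij_betw_imp_surj_on[OF bij] assms(3)
    unfolding iff inj_on_def image_iff set_eq_iff by (smt (verit) image_eqI image_iff)
  from theI'[OF this] show "line_index n P d p \<in> {1..n}"
    and "torus_line n d (P d (line_index n P d p)) = torus_line n d p"
    unfolding line_index_def iff by auto
qed

lemma line_sum_line_index:
  assumes "line_points n P" and "admissible_dir n d" and "p \<in> grid n"
  shows "line_sum n P f d (line_index n P d p) = (\<Sum>q\<in>torus_line n d p. f q)"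
  unfolding line_sum_def line_index_torus_line(2)[OF assms] ..

text \<open>Frees the constraints from \<open>P\<close>: a grid point reaches its line through
  \<open>line_index\<close>, and conversely \<open>P d t\<close> is itself a grid point.\<close>

lemma same_line_sums_iff:
  assumes "line_points n P" and "\<forall>d\<in>S. admissible_dir n d"
  shows "f \<in> same_line_sums n P S g \<longleftrightarrow> f \<in> grid n \<rightarrow>\<^sub>E UNIV \<and>
    (\<forall>d\<in>S. \<forall>p\<in>grid n. (\<Sum>q\<in>torus_line n d p. f q) = (\<Sum>q\<in>torus_line n d p. g q))"
    (is "_ \<longleftrightarrow> _ \<and> ?eq")
proof -
  have "(\<forall>d\<in>S. \<forall>t\<in>{1..n}. line_sum n P f d t = line_sum n P g d t) \<longleftrightarrow> ?eq"
  proof (intro iffI ballI)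
    fix d p
    assume H: "\<forall>d\<in>S. \<forall>t\<in>{1..n}. line_sum n P f d t = line_sum n P g d t"
      and "d \<in> S" "p \<in> grid n"
    thus "(\<Sum>q\<in>torus_line n d p. f q) = (\<Sum>q\<in>torus_line n d p. g q)"
      using line_sum_line_index line_index_torus_line(1) assms by metis
  next
    fix d t assume "?eq" "d \<in> S" "t \<in> {1..n}"
    moreover from this have "P d t \<in> grid n"
      using assms unfolding line_points_def by blast
    ultimately show "line_sum n P f d t = line_sum n P g d t"
      unfolding line_sum_def by blast
  qed
  thus ?thesis
    unfolding same_line_sums_def by blast
qed

section \<open>Orthogonality and minimality\<close>

text \<open>Replacing a function by its line sums is a self-adjoint operation, so the line sums can
  be moved from \<open>g\<close> onto \<open>h\<close>.\<close>

lemma zero_line_sums_orthogonal: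
  fixes h g :: "int \<times> int \<Rightarrow> real"
  assumes "\<forall>p\<in>grid n. (\<Sum>q\<in>torus_line n d p. h q) = 0"
  shows "(\<Sum>p\<in>grid n. h p * (\<Sum>q\<in>torus_line n d p. g q)) = 0"
proof -
  have "(\<Sum>p\<in>grid n. h p * (\<Sum>q\<in>torus_line n d p. g q))
      = (\<Sum>q\<in>grid n. (\<Sum>p\<in>torus_line n d q. h p * g q))"
    unfolding sum_distrib_left by (rule sum_torus_line_swap)
  also have "\<dots> = 0"
    using assms by (simp flip: sum_distrib_right)
  finally show ?thesis .
qed

text \<open>Pythagoras for \<open>f = (f - u) + u\<close>; a point where \<open>f\<close> and
  \<open>u\<close> differ makes the inequality strict.\<close>

lemma L2_set_less_orthogonal:
  assumes "finite A" and "(\<Sum>p\<in>A. (f p - u p) * u p) = 0"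
    and "q \<in> A" and "f q \<noteq> u q"
  shows "L2_set u A < L2_set f A"
proof -
  have "(\<Sum>p\<in>A. (f p)\<^sup>2) = (\<Sum>p\<in>A. (f p - u p)\<^sup>2 + (2 * ((f p - u p) * u p) + (u p)\<^sup>2))"
    by (intro sum.cong refl) (simp add: power2_eq_square algebra_simps)
  also have "\<dots> = (\<Sum>p\<in>A. (f p - u p)\<^sup>2) + (\<Sum>p\<in>A. (u p)\<^sup>2)"
    using assms(2) by (simp add: sum.distrib flip: sum_distrib_left)
  finally have "(\<Sum>p\<in>A. (f p)\<^sup>2) = (\<Sum>p\<in>A. (f p - u p)\<^sup>2) + (\<Sum>p\<in>A. (u p)\<^sup>2)" .
  moreover have "(\<Sum>p\<in>A. (f p - u p)\<^sup>2) > 0"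
    using assms by (intro sum_pos2[of A q]) auto
  ultimately show ?thesis
    by (simp add: L2_set_def)
qed

theorem theorem6p5:
  fixes n :: nat
    and S :: "(int \<times> int) set"
    and P :: "int \<times> int \<Rightarrow> nat \<Rightarrow> int \<times> int"
    and g f\<^sub>0 :: "int \<times> int \<Rightarrow> real"
  assumes "n > 0"
    and "\<forall>d\<in>S. admissible_dir n d"
    and "pairwise (independent_dirs n) S"
    and "S \<noteq> {}"
    and "line_points n P"
    and "g \<in> grid n \<rightarrow>\<^sub>E UNIV"
  defines "f\<^sub>0 \<equiv> (\<lambda>p\<in>grid n.
      (\<Sum>d\<in>S. line_sum n P g d (line_index n P d p) / real n)
        - (real (card S) - 1) * (\<Sum>q\<in>grid n. g q) / (real n)\<^sup>2)"
  shows "f\<^sub>0 \<in> same_line_sums n P S g \<and>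
    (\<forall>f\<in>same_line_sums n P S g. f \<noteq> f\<^sub>0 \<longrightarrow> L2_set f\<^sub>0 (grid n) < L2_set f (grid n))"
proof -
  define L where "L d p = (\<Sum>q\<in>torus_line n d p. g q)" for d p
  define D where "D = (\<Sum>q\<in>grid n. g q)"
  define c where "c = (real (card S) - 1) * D / (real n)\<^sup>2"
  \<comment> \<open>The coordinates of an admissible direction lie in the range of the grid; this
    makes \<open>S\<close> finite and \<open>card S\<close> meaningful.\<close>
  have "S \<subseteq> grid n"
    using assms(2) by (auto simp: grid_def)
  hence fin: "finite S"
    by (rule finite_subset) simp
  have f0: "f\<^sub>0 p = (\<Sum>d\<in>S. L d p / real n) - c" if "p \<in> grid n" for p
  proof -
    have "line_sum n P g d (line_index n P d p) = L d p" if "d \<in> S" for d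
      using line_sum_line_index assms(2,5) that \<open>p \<in> grid n\<close> by (simp add: L_def)
    thus ?thesis
      using that by (simp add: f\<^sub>0_def c_def D_def)
  qed
  have sums: "(\<Sum>q\<in>torus_line n d p. f\<^sub>0 q) = L d p" if d: "d \<in> S" and "p \<in> grid n" for d p
  proof -
    have card: "card (torus_line n d p) = n"
      using card_torus_line assms(1,2) d by blast
    \<comment> \<open>\<open>L d\<close> is constant along a \<open>d\<close>-line, which has
      \<open>n\<close> points.\<close>
    have "(\<Sum>q\<in>torus_line n d p. L d q) = real n * L d p"
      using torus_line_eq card by (simp add: L_def)
    moreover have "(\<Sum>q\<in>torus_line n d p. L e q) = D" if "e \<in> S - {d}" for e
    proof -
      have "independent_dirs n d e"
        using assms(3) d that unfolding pairwise_def by auto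
      thus ?thesis
        unfolding L_def D_def by (rule sum_torus_line_independent[OF assms(1)])
    qed
    moreover have "real (card (S - {d})) = real (card S) - 1"
      using card.remove[OF fin d] by simp
    ultimately have total: "(\<Sum>e\<in>S. \<Sum>q\<in>torus_line n d p. L e q)
        = real n * L d p + (real (card S) - 1) * D"
      by (subst sum.remove[OF fin d]) (simp del: card_Diff_insert)
    have "(\<Sum>q\<in>torus_line n d p. f\<^sub>0 q)
        = (\<Sum>q\<in>torus_line n d p. (\<Sum>e\<in>S. L e q / real n) - c)"
      by (intro sum.cong refl f0 subsetD[OF torus_line_subset])
    \<comment> \<open>The directions other than \<open>d\<close> contribute an excess of
      \<open>(card S - 1) * D / n\<close> per line, which is exactly the \<open>n * c\<close>
      subtracted.\<close>
    also have "\<dots> = (\<Sum>e\<in>S. \<Sum>q\<in>torus_line n d p. L e q) / real n - real n * c"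
      by (simp add: sum_subtractf card sum.swap[of _ S] sum_divide_distrib)
    also have "\<dots> = L d p"
      unfolding total c_def using assms(1) by (simp add: field_simps power2_eq_square)
    finally show ?thesis .
  qed
  have "f\<^sub>0 \<in> grid n \<rightarrow>\<^sub>E UNIV"
    by (simp add: f\<^sub>0_def)
  hence mem: "f\<^sub>0 \<in> same_line_sums n P S g"
    using sums by (simp add: same_line_sums_iff[OF assms(5,2)] L_def)
  have "L2_set f\<^sub>0 (grid n) < L2_set f (grid n)"
    if f: "f \<in> same_line_sums n P S g" and ne: "f \<noteq> f\<^sub>0" for f
  proof -
    define h where "h p = f p - f\<^sub>0 p" for p
    have zero: "\<forall>p\<in>grid n. (\<Sum>q\<in>torus_line n d p. h q) = 0" if "d \<in> S" for d
      using f sums that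
      by (simp add: same_line_sums_iff[OF assms(5,2)] h_def sum_subtractf L_def)
    have orth: "(\<Sum>p\<in>grid n. h p * L d p) = 0" if "d \<in> S" for d
      unfolding L_def using zero_line_sums_orthogonal[OF zero[OF that]] .
    \<comment> \<open>The constant term of \<open>f\<^sub>0\<close> requires \<open>h\<close> to
      have total sum 0. One direction suffices: the constant function 1 has all its line sums equal
      to \<open>n\<close>.\<close>
    obtain d where "d \<in> S"
      using assms(4) by blast
    hence "(\<Sum>p\<in>grid n. h p * real n) = 0"
      using zero_line_sums_orthogonal[OF zero, of d "\<lambda>_. 1"] card_torus_line assms(1,2) by simp
    hence total: "(\<Sum>p\<in>grid n. h p) = 0"
      using assms(1) by (simp flip: sum_distrib_right)
    have "(\<Sum>p\<in>grid n. h p * f\<^sub>0 p)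
        = (\<Sum>p\<in>grid n. (\<Sum>d\<in>S. h p * L d p / real n) - h p * c)"
      using f0 by (intro sum.cong) (simp_all add: right_diff_distrib sum_distrib_left)
    also have "\<dots> = (\<Sum>d\<in>S. (\<Sum>p\<in>grid n. h p * L d p) / real n) - (\<Sum>p\<in>grid n. h p) * c"
      by (simp add: sum_subtractf sum.swap[of _ S] sum_divide_distrib sum_distrib_right)
    also have "\<dots> = 0"
      using orth total by simp
    finally have "(\<Sum>p\<in>grid n. (f p - f\<^sub>0 p) * f\<^sub>0 p) = 0"
      by (simp add: h_def)
    \<comment> \<open>Both functions are extensional, so being different means differing at a grid
      point.\<close>
    moreover obtain q where "q \<in> grid n" "f q \<noteq> f\<^sub>0 q"
      using ne f mem PiE_ext[of f "grid n" "\<lambda>_. UNIV" f\<^sub>0]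
      by (auto simp: same_line_sums_def)
    ultimately show ?thesis
      by (intro L2_set_less_orthogonal) auto
  qed
  with mem show ?thesis
    by blast
qed

end
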